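(* Let $K/F$ be a finite field extension with norm $N_{K/F}:K\to F$, let $\sigma\in \mathrm{Aut}_F(K)$ with $\sigma\neq\mathrm{id}$, and let $c\in K^{\times}$. If $N_{K/F}(c)\neq N_{K/F}(a^2)$ for all $a\in K^{\times}$, then $D(K,\sigma,c)$ is a division algebra.
   Context: $D(K,\sigma,c)$ denotes the $F$-vector space $K\oplus K$ with multiplication $(u,v)(x,y)=(ux+c\,\sigma(vy),\,uy+vx)$ for $u,v,x,y\in K$; it is a unital commutative, not necessarily associative, finite-dimensional $F$-algebra. A finite-dimensional (nonassociative) $F$-algebra $A$ is a division algebra if for every nonzero $a\in A$ the maps $x\mapsto ax$ and $x\mapsto xa$ are bijective; equivalently, $A$ has no zero divisors. The field $F$ is arbitrary. *)

theory Defs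
  imports
    "Jordan_Normal_Form.Determinant"
    "HOL-Library.Product_Plus"
begin

text \<open>A field extension \<open>K/F\<close> is given by an embedding \<open>\<iota>\<close> of the field of all elements of type
  \<open>'f\<close> into that of type \<open>'k\<close>; it makes \<open>K\<close> an \<open>F\<close>-vector space.\<close>

definition finite_dimensional :: "('f::field \<Rightarrow> 'a::ab_group_add \<Rightarrow> 'a) \<Rightarrow> bool" where
  "finite_dimensional scale \<longleftrightarrow> (\<exists>B. finite B \<and> module.span scale B = UNIV)"

locale finite_field_extension = field_hom \<iota>
  for \<iota> :: "'f::field \<Rightarrow> 'k::field" +
  assumes finite_degree: "finite_dimensional (\<lambda>a x. \<iota> a * x)"
begin

sublocale vector_space "\<lambda>a x. \<iota> a * x"
  by unfold_locales (simp_all add: hom_distribs algebra_simps)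

definition is_basis :: "'k list \<Rightarrow> bool" where
  "is_basis bs \<longleftrightarrow> distinct bs \<and> independent (set bs) \<and> span (set bs) = UNIV"

lemma ex_basis: "\<exists>bs. is_basis bs"
proof -
  obtain B where "finite B" and B: "span B = UNIV"
    using finite_degree unfolding finite_dimensional_def by blast
  obtain C where C: "C \<subseteq> B" "independent C" "B \<subseteq> span C"
    by (rule maximal_independent_subset)
  from C(3) have "span B \<subseteq> span C"
    by (rule span_minimal) (rule subspace_span)
  with B have "span C = UNIV" by blast
  moreover obtain bs where "set bs = C" "distinct bs"
    using finite_distinct_list[OF finite_subset[OF C(1) \<open>finite B\<close>]] by blast
  ultimately show ?thesis using C(2) unfolding is_basis_def by blast
qed

text \<open>Column \<open>j\<close> holds the coordinates of \<open>x * b\<^sub>j\<close>.\<close>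

definition mult_matrix :: "'k list \<Rightarrow> 'k \<Rightarrow> 'f mat" where
  "mult_matrix bs x = mat (length bs) (length bs)
     (\<lambda>(i, j). representation (set bs) (x * bs ! j) (bs ! i))"

text \<open>\<open>N\<^bsub>K/F\<^esub>(x)\<close> is the determinant of the \<open>F\<close>-linear map \<open>y \<mapsto> x * y\<close>. The choice of basis is
  immaterial, since a change of basis conjugates the matrix.\<close>

definition field_norm :: "'k \<Rightarrow> 'f" where
  "field_norm x = det (mult_matrix (SOME bs. is_basis bs) x)"

definition Aut :: "('k \<Rightarrow> 'k) set" where
  "Aut = {\<sigma>. field_isom \<sigma> \<and> (\<forall>a. \<sigma> (\<iota> a) = \<iota> a)}"

end

locale nonassoc_algebra = vector_space scale
  for scale :: "'f::field \<Rightarrow> 'a::ab_group_add \<Rightarrow> 'a" +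
  fixes mult :: "'a \<Rightarrow> 'a \<Rightarrow> 'a"
  assumes linear_mult_left: "Vector_Spaces.linear scale scale (\<lambda>x. mult x a)"
    and linear_mult_right: "Vector_Spaces.linear scale scale (\<lambda>x. mult a x)"

locale division_algebra = nonassoc_algebra scale mult
  for scale :: "'f::field \<Rightarrow> 'a::ab_group_add \<Rightarrow> 'a" and mult :: "'a \<Rightarrow> 'a \<Rightarrow> 'a" +
  assumes fin_dim: "finite_dimensional scale"
    and bij_mult_left: "a \<noteq> 0 \<Longrightarrow> bij (\<lambda>x. mult a x)"
    and bij_mult_right: "a \<noteq> 0 \<Longrightarrow> bij (\<lambda>x. mult x a)"

text \<open>The algebra \<open>D(K,\<sigma>,c)\<close> on \<open>K \<oplus> K\<close>, with componentwise addition.\<close>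

definition D_scale :: "('f::field \<Rightarrow> 'k::field) \<Rightarrow> 'f \<Rightarrow> 'k \<times> 'k \<Rightarrow> 'k \<times> 'k" where
  "D_scale \<iota> a = (\<lambda>(u, v). (\<iota> a * u, \<iota> a * v))"

definition D_mult :: "('k::field \<Rightarrow> 'k) \<Rightarrow> 'k \<Rightarrow> 'k \<times> 'k \<Rightarrow> 'k \<times> 'k \<Rightarrow> 'k \<times> 'k" where
  "D_mult \<sigma> c = (\<lambda>(u, v) (x, y). (u * x + c * \<sigma> (v * y), u * y + v * x))"

end

theory Submission
  imports Defs
begin

text \<open>If nonzero elements \<open>(u, v)\<close> and \<open>(x, y)\<close> multiply to zero, then \<open>u\<close>, \<open>v\<close>, \<open>x\<close>, \<open>y\<close> are all
  nonzero, and eliminating \<open>x\<close> gives \<open>c = (u / v)\<^sup>2 * (v / \<sigma> v) * (y / \<sigma> y)\<close>. As the norm is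
  multiplicative and \<open>\<sigma>\<close>-invariant, \<open>c\<close> then has the norm of the square \<open>(u / v)\<^sup>2\<close>.
  So multiplication by a nonzero element is injective, hence bijective in finite dimension.\<close>

context vector_space
begin

text \<open>A maximal independent subset of a finite spanning set is a finite basis. Over it the
  space becomes a \<open>finite_dimensional_vector_space\<close>, where injective endomorphisms are
  surjective.\<close>

lemma finite_dimensional_inj_imp_surj:
  assumes "finite_dimensional scale" "Vector_Spaces.linear scale scale f" "inj f"
  shows "surj f"
proof -
  obtain B where "finite B" and B: "span B = UNIV"
    using assms(1) unfolding finite_dimensional_def by blast
  obtain C where C: "C \<subseteq> B" "independent C" "B \<subseteq> span C"
    by (rule maximal_independent_subset)
  have "span B \<subseteq> span C"
    using C(3) subspace_span by (rule span_minimal)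
  then interpret finite_dimensional_vector_space scale C
    using B C \<open>finite B\<close> by unfold_locales (use finite_subset in \<open>blast+\<close>)
  show ?thesis
    using assms(2,3) by (rule linear_inj_imp_surj)
qed

end

context finite_field_extension
begin

text \<open>Extends \<open>mult_matrix\<close> from multiplications to arbitrary maps, so that an
  automorphism and its inverse also have matrices.\<close>

definition matrix_of :: "'k list \<Rightarrow> ('k \<Rightarrow> 'k) \<Rightarrow> 'f mat" where
  "matrix_of bs f = mat (length bs) (length bs)
     (\<lambda>(i, j). representation (set bs) (f (bs ! j)) (bs ! i))"

lemma matrix_of_carrier [simp]: "matrix_of bs f \<in> carrier_mat (length bs) (length bs)"
  by (simp add: matrix_of_def)

lemma matrix_of_id:
  assumes "distinct bs" "independent (set bs)"
  shows "matrix_of bs (\<lambda>x. x) = 1\<^sub>m (length bs)"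
  using assms by (intro eq_matI)
    (auto simp: matrix_of_def representation_basis nth_eq_iff_index_eq)

text \<open>Expand \<open>g\<close> of a basis vector in the basis and apply the linear map
  \<open>f\<close> termwise. Here \<open>g\<close> may be any function, so it can later be an
  inverse map whose linearity has not been established.\<close>

lemma matrix_of_compose:
  assumes "distinct bs" "independent (set bs)" "span (set bs) = UNIV"
    and "Vector_Spaces.linear (\<lambda>a x. \<iota> a * x) (\<lambda>a x. \<iota> a * x) f"
  shows "matrix_of bs (\<lambda>x. f (g x)) = matrix_of bs f * matrix_of bs g"
proof (rule eq_matI)
  interpret f: Vector_Spaces.linear "\<lambda>a x. \<iota> a * x" "\<lambda>a x. \<iota> a * x" f by fact
  let ?R = "representation (set bs)"
  \<comment> \<open>The coordinates of \<open>f x\<close> are the matrix of \<open>f\<close> applied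
    to those of \<open>x\<close>. The sum over basis vectors is reindexed by their positions in
    \<open>bs\<close> to match matrix indices.\<close>
  have R_f: "?R (f x) b = (\<Sum>k<length bs. ?R (f (bs ! k)) b * ?R x (bs ! k))" for x b
  proof -
    have "x = (\<Sum>d\<in>set bs. \<iota> (?R x d) * d)"
      using assms by (subst sum_representation_eq) auto
    also have "f \<dots> = (\<Sum>d\<in>set bs. \<iota> (?R x d) * f d)"
      by (simp add: f.sum f.scale)
    finally have "?R (f x) b = (\<Sum>d\<in>set bs. ?R (f d) b * ?R x d)"
      using assms by (simp add: representation_sum representation_scale mult.commute[of "?R x _"])
    also have "\<dots> = (\<Sum>k<length bs. ?R (f (bs ! k)) b * ?R x (bs ! k))"
      by (rule sum.reindex_bij_betw[symmetric]) (rule bij_betw_nth[OF \<open>distinct bs\<close> refl refl])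
    finally show ?thesis .
  qed
  fix i j
  assume "i < dim_row (matrix_of bs f * matrix_of bs g)"
    and "j < dim_col (matrix_of bs f * matrix_of bs g)"
  then have "i < length bs" "j < length bs" by (simp_all add: matrix_of_def)
  then show "matrix_of bs (\<lambda>x. f (g x)) $$ (i, j) = (matrix_of bs f * matrix_of bs g) $$ (i, j)"
    by (simp add: matrix_of_def scalar_prod_def R_f[of "g (bs ! j)"] lessThan_atLeast0)
qed (simp_all add: matrix_of_def)

lemma linear_times: "Vector_Spaces.linear (\<lambda>a x. \<iota> a * x) (\<lambda>a x. \<iota> a * x) ((*) x)"
  by unfold_locales (simp_all add: algebra_simps)

definition norm_basis :: "'k list" where
  "norm_basis = (SOME bs. is_basis bs)"

lemma norm_basis: "distinct norm_basis" "independent (set norm_basis)" "span (set norm_basis) = UNIV"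
  using someI_ex[OF ex_basis] unfolding norm_basis_def is_basis_def by blast+

lemma field_norm_eq_det: "field_norm x = det (matrix_of norm_basis ((*) x))"
  by (simp add: field_norm_def mult_matrix_def matrix_of_def norm_basis_def)

lemma field_norm_mult: "field_norm (x * y) = field_norm x * field_norm y"
proof -
  have "(*) (x * y) = (\<lambda>z. x * (y * z))"
    by (simp add: fun_eq_iff mult.assoc)
  then show ?thesis
    by (simp add: field_norm_eq_det matrix_of_compose[OF norm_basis linear_times, of x "(*) y"]
        det_mult[of _ "length norm_basis"])
qed

lemma field_norm_1: "field_norm 1 = 1"
proof -
  have "(*) 1 = (\<lambda>x::'k. x)" by (simp add: fun_eq_iff)
  then show ?thesis
    by (simp add: field_norm_eq_det matrix_of_id[OF norm_basis(1,2)])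
qed

text \<open>The norms of \<open>x\<close> and \<open>inverse x\<close> multiply to the norm of 1,
  which is 1.\<close>

lemma field_norm_nonzero:
  assumes "x \<noteq> 0"
  shows "field_norm x \<noteq> 0"
  using field_norm_mult[of x "inverse x"] assms by (auto simp: field_norm_1)

lemma Aut_linear:
  assumes "\<sigma> \<in> Aut"
  shows "Vector_Spaces.linear (\<lambda>a x. \<iota> a * x) (\<lambda>a x. \<iota> a * x) \<sigma>"
proof -
  interpret \<sigma>: field_isom \<sigma> using assms by (simp add: Aut_def)
  show ?thesis using assms
    by unfold_locales (simp_all add: Aut_def \<sigma>.hom_add \<sigma>.hom_mult)
qed

text \<open>Multiplication by \<open>\<sigma> x\<close> is multiplication by \<open>x\<close>
  conjugated by \<open>\<sigma>\<close>, and conjugate maps have equal determinants.\<close>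

lemma field_norm_Aut:
  assumes "\<sigma> \<in> Aut"
  shows "field_norm (\<sigma> x) = field_norm x"
proof -
  interpret \<sigma>: field_isom \<sigma> using assms by (simp add: Aut_def)
  let ?M = "matrix_of norm_basis" and ?n = "length norm_basis"
  define \<tau> where "\<tau> = inv_into UNIV \<sigma>"
  have inv: "\<sigma> (\<tau> y) = y" for y
    by (simp add: \<tau>_def)
  have "?M ((*) (\<sigma> x)) = ?M (\<lambda>y. \<sigma> (x * \<tau> y))"
    by (rule arg_cong[of _ _ ?M]) (simp add: fun_eq_iff \<sigma>.hom_mult inv)
  also have "\<dots> = ?M \<sigma> * (?M ((*) x) * ?M \<tau>)"
    by (simp add: matrix_of_compose[OF norm_basis Aut_linear[OF assms], of "\<lambda>y. x * \<tau> y"]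
        matrix_of_compose[OF norm_basis linear_times, of x \<tau>])
  \<comment> \<open>Determinants commute, so the two outer factors can be collected into one
    product, which is the identity matrix.\<close>
  finally have "field_norm (\<sigma> x) = field_norm x * det (?M \<sigma> * ?M \<tau>)"
    by (simp add: field_norm_eq_det det_mult[of _ ?n] mult_carrier_mat[of _ ?n ?n])
  also have "?M \<sigma> * ?M \<tau> = 1\<^sub>m ?n"
    using matrix_of_compose[OF norm_basis Aut_linear[OF assms], of \<tau>]
      matrix_of_id[OF norm_basis(1,2)] by (simp add: inv)
  finally show ?thesis by simp
qed

lemma D_nonassoc_algebra:
  assumes "\<sigma> \<in> Aut"
  shows "nonassoc_algebra (D_scale \<iota>) (D_mult \<sigma> c)"
proof -
  interpret \<sigma>: field_isom \<sigma> using assms by (simp add: Aut_def)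
  show ?thesis using assms
    by unfold_locales (auto simp: D_scale_def D_mult_def Aut_def hom_distribs
        \<sigma>.hom_add \<sigma>.hom_mult algebra_simps)
qed

text \<open>The images of a finite spanning set of \<open>K\<close> under the two coordinate
  inclusions together span the direct sum.\<close>

lemma D_finite_dimensional: "finite_dimensional (D_scale \<iota>)"
proof -
  interpret D: vector_space "D_scale \<iota>"
    by unfold_locales (auto simp: D_scale_def hom_distribs algebra_simps)
  interpret l: Vector_Spaces.linear "\<lambda>a x. \<iota> a * x" "D_scale \<iota>" "\<lambda>x. (x, 0)"
    by unfold_locales (auto simp: D_scale_def)
  interpret r: Vector_Spaces.linear "\<lambda>a x. \<iota> a * x" "D_scale \<iota>" "\<lambda>x. (0, x)"
    by unfold_locales (auto simp: D_scale_def)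
  obtain B where "finite B" and B: "span B = UNIV"
    using finite_degree unfolding finite_dimensional_def by blast
  let ?B = "(\<lambda>x. (x, 0)) ` B \<union> (\<lambda>x. (0, x)) ` B"
  have "(x, y) \<in> D.span ?B" for x y
  proof -
    have "(x, 0) \<in> D.span ((\<lambda>x. (x, 0)) ` B)" "(0, y) \<in> D.span ((\<lambda>x. (0, x)) ` B)"
      by (simp_all add: l.span_image r.span_image B)
    then have "(x, 0) + (0, y) \<in> D.span ?B"
      by (intro D.span_add) (auto intro: D.span_mono[THEN subsetD, rotated])
    then show ?thesis by simp
  qed
  then have "D.span ?B = UNIV" by auto
  with \<open>finite B\<close> show ?thesis
    unfolding finite_dimensional_def by (intro exI[of _ ?B]) simp
qed

lemma D_no_zero_divisors:
  assumes \<sigma>: "\<sigma> \<in> Aut" and "c \<noteq> 0"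
    and norm: "\<And>a. a \<noteq> 0 \<Longrightarrow> field_norm c \<noteq> field_norm (a ^ 2)"
    and "D_mult \<sigma> c p q = 0"
  shows "p = 0 \<or> q = 0"
proof (rule ccontr)
  interpret \<sigma>: field_isom \<sigma> using \<sigma> by (simp add: Aut_def)
  assume "\<not> (p = 0 \<or> q = 0)"
  moreover obtain u v x y where pq: "p = (u, v)" "q = (x, y)"
    by (cases p, cases q)
  ultimately have nz: "u \<noteq> 0 \<or> v \<noteq> 0" "x \<noteq> 0 \<or> y \<noteq> 0"
    by (auto simp: zero_prod_def)
  have eq: "u * x + c * (\<sigma> v * \<sigma> y) = 0" "u * y + v * x = 0"
    using assms(4) by (auto simp: pq D_mult_def zero_prod_def \<sigma>.hom_mult)
  \<comment> \<open>If \<open>v = 0\<close>, then \<open>u\<close> is nonzero and the equations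
    force \<open>x = y = 0\<close>. Next, \<open>y = 0\<close> would give \<open>v * x = 0\<close>,
    hence \<open>x = 0\<close>. Finally, \<open>u = 0\<close> would leave a vanishing product of
    \<open>c\<close>, \<open>\<sigma> v\<close> and \<open>\<sigma> y\<close>.\<close>
  have "v \<noteq> 0" using eq nz by auto
  have "y \<noteq> 0" using eq nz \<open>v \<noteq> 0\<close> by auto
  have \<sigma>vy: "\<sigma> v \<noteq> 0" "\<sigma> y \<noteq> 0" using \<open>v \<noteq> 0\<close> \<open>y \<noteq> 0\<close> by simp_all
  have "u \<noteq> 0" using eq \<sigma>vy \<open>c \<noteq> 0\<close> by auto
  have x: "x = - (u * y) / v"
    using eq(2) \<open>v \<noteq> 0\<close> by (simp add: field_simps eq_neg_iff_add_eq_0)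
  have "c * (\<sigma> v * \<sigma> y) = (u / v) ^ 2 * (v * y)"
    using eq(1) \<open>v \<noteq> 0\<close> by (simp add: x field_simps power2_eq_square)
  \<comment> \<open>On taking norms, \<open>\<sigma> v\<close> and \<open>\<sigma> y\<close> may be
    replaced by \<open>v\<close> and \<open>y\<close>, so both sides share a nonzero factor that
    cancels.\<close>
  then have "field_norm c * (field_norm v * field_norm y)
      = field_norm ((u / v) ^ 2) * (field_norm v * field_norm y)"
    by (metis field_norm_mult field_norm_Aut[OF \<sigma>])
  then have "field_norm c = field_norm ((u / v) ^ 2)"
    using field_norm_nonzero \<open>v \<noteq> 0\<close> \<open>y \<noteq> 0\<close> by simp
  with norm[of "u / v"] \<open>u \<noteq> 0\<close> \<open>v \<noteq> 0\<close> show False by simp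
qed

end

theorem corollary2p4:
  fixes \<iota> :: "'f::field \<Rightarrow> 'k::field" and \<sigma> :: "'k \<Rightarrow> 'k" and c :: 'k
  assumes "finite_field_extension \<iota>"
    and "\<sigma> \<in> finite_field_extension.Aut \<iota>" and "\<sigma> \<noteq> id"
    and "c \<noteq> 0"
    and "\<And>a. a \<noteq> 0 \<Longrightarrow>
      finite_field_extension.field_norm \<iota> c \<noteq> finite_field_extension.field_norm \<iota> (a ^ 2)"
  shows "division_algebra (D_scale \<iota>) (D_mult \<sigma> c)"
proof -
  interpret K: finite_field_extension \<iota> by fact
  interpret D: nonassoc_algebra "D_scale \<iota>" "D_mult \<sigma> c"
    by (rule K.D_nonassoc_algebra) fact
  note no_zero_div = K.D_no_zero_divisors[OF assms(2,4,5)]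
  \<comment> \<open>Stated for any linear map with trivial kernel, so that it serves left and right
    multiplications alike.\<close>
  have bij: "bij f"
    if lin: "Vector_Spaces.linear (D_scale \<iota>) (D_scale \<iota>) f" and "\<And>x. f x = 0 \<Longrightarrow> x = 0" for f
  proof -
    interpret f: Vector_Spaces.linear "D_scale \<iota>" "D_scale \<iota>" f by (rule lin)
    have "inj f"
      using that(2) by (simp add: f.inj_iff_eq_0)
    with D.finite_dimensional_inj_imp_surj[OF K.D_finite_dimensional lin] show ?thesis
      by (simp add: bij_def)
  qed
  show ?thesis
  proof unfold_locales
    show "finite_dimensional (D_scale \<iota>)" by (rule K.D_finite_dimensional)
  next
    fix p :: "'k \<times> 'k"
    assume "p \<noteq> 0"
    show "bij (D_mult \<sigma> c p)"
      \<comment> \<open>Left multiplication by \<open>p\<close> is linear in the right factor, hence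
        the crossed names.\<close>
      by (rule bij[OF D.linear_mult_right]) (use no_zero_div \<open>p \<noteq> 0\<close> in blast)
    show "bij (\<lambda>q. D_mult \<sigma> c q p)"
      by (rule bij[OF D.linear_mult_left]) (use no_zero_div \<open>p \<noteq> 0\<close> in blast)
  qed
qed

end
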